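(* Let $\rho\in(0,1)$ be irrational. If $p_n/q_n$ is a continued fraction convergent of $\rho$, then the graph of $z\mapsto\nu(\rho,q_n,z)$ is an isosceles trapezoid of step $q_n$.
   Context: $\{t\}=t-\lfloor t\rfloor$ denotes the fractional part. For a positive integer $m$ and $x\in[0,1)$, $S(\rho,m,x)=\sum_{i=1}^{m}\left(\{x+i\rho\}-\tfrac12\right)$, and for $z\in\mathbb{R}$ the Birkhoff density is $\nu(\rho,m,z)=\frac1m\,\#\{x\in[0,1): S(\rho,m,x)=z\}$. Continued fractions: write $\rho=[a_1,a_2,\dots]$ for the continued fraction $\rho=1/(a_1+1/(a_2+\cdots))$ with positive integers $a_i$. The convergents $p_n/q_n$ are given by $p_0=0$, $p_1=1$, $q_0=1$, $q_1=a_1$, and $p_{n+1}=a_{n+1}p_n+p_{n-1}$, $q_{n+1}=a_{n+1}q_n+q_{n-1}$ for $n\ge1$. A function $v$ on $\mathbb{R}$ is a trapezoid of step $N$ if there are numbers $0<t_1<t_2<\dots<t_N$ such that: (a) the set of nonzero values of $v$ is $\{t_i:1\le i\le N\}$, and $v^{-1}(\{t_N\})$ is a single interval (open or half-open); (b) for $1\le i\le N-1$ the set $v^{-1}(\{t_i\})$ is a union of two intervals, and these $2(N-1)$ intervals are of equal length; (c) $\inf v^{-1}(\{t_1\})<\inf v^{-1}(\{t_2\})<\dots<\inf v^{-1}(\{t_N\})$, and the corresponding right endpoints $\sup v^{-1}(\{t_i\})$ form a decreasing sequence. Such a trapezoid is isosceles if it is symmetric under $z\mapsto -z$.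
   Formalization: Symmetry under z ↦ −z is claimed only at continuity points of ν (all z except the step endpoints); pointwise symmetry fails, e.g. for q_0 = 1, where ν is the indicator of [−1/2, 1/2). *)

theory Defs
  imports "HOL-Analysis.Analysis"
begin

definition birkhoff_sum :: "real \<Rightarrow> nat \<Rightarrow> real \<Rightarrow> real" where
  "birkhoff_sum \<rho> m x = (\<Sum>i=1..m. (frac (x + real i * \<rho>) - 1/2))"

(* For m \<ge> 1 the sum is piecewise affine in x with slope m and finitely many pieces,
   so the set counted here is finite. *)
definition birkhoff_density :: "real \<Rightarrow> nat \<Rightarrow> real \<Rightarrow> real" where
  "birkhoff_density \<rho> m z = real (card {x \<in> {0..<1}. birkhoff_sum \<rho> m x = z}) / real m"

(* cf_trunc a k n = 1/(a k + 1/(a (k+1) + ... + 1/a (k+n-1))) *)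
fun cf_trunc :: "(nat \<Rightarrow> nat) \<Rightarrow> nat \<Rightarrow> nat \<Rightarrow> real" where
  "cf_trunc a k 0 = 0"
| "cf_trunc a k (Suc n) = 1 / (real (a k) + cf_trunc a (Suc k) n)"

(* Partial quotients are indexed from 1; the value of a at 0 is irrelevant. *)
definition cf_expansion :: "real \<Rightarrow> (nat \<Rightarrow> nat) \<Rightarrow> bool" where
  "cf_expansion \<rho> a \<longleftrightarrow> (\<forall>i\<ge>1. a i > 0) \<and> (\<lambda>n. cf_trunc a 1 n) \<longlonglongrightarrow> \<rho>"

fun cf_num :: "(nat \<Rightarrow> nat) \<Rightarrow> nat \<Rightarrow> nat" where
  "cf_num a 0 = 0"
| "cf_num a (Suc 0) = 1"
| "cf_num a (Suc (Suc n)) = a (Suc (Suc n)) * cf_num a (Suc n) + cf_num a n"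

fun cf_den :: "(nat \<Rightarrow> nat) \<Rightarrow> nat \<Rightarrow> nat" where
  "cf_den a 0 = 1"
| "cf_den a (Suc 0) = a 1"
| "cf_den a (Suc (Suc n)) = a (Suc (Suc n)) * cf_den a (Suc n) + cf_den a n"

definition cf_convergent :: "real \<Rightarrow> nat \<Rightarrow> nat \<Rightarrow> bool" where
  "cf_convergent \<rho> p q \<longleftrightarrow>
     (\<exists>a n. cf_expansion \<rho> a \<and> p = cf_num a n \<and> q = cf_den a n)"

definition open_or_half_open_interval :: "real set \<Rightarrow> bool" where
  "open_or_half_open_interval I \<longleftrightarrow>
     (\<exists>a b. a < b \<and> (I = {a<..<b} \<or> I = {a..<b} \<or> I = {a<..b}))"

definition interval_of_length :: "real \<Rightarrow> real set \<Rightarrow> bool" where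
  "interval_of_length l I \<longleftrightarrow>
     is_interval I \<and> bounded I \<and> I \<noteq> {} \<and> Sup I - Inf I = l"

(* The common length l of the lateral steps is positive, i.e. no step is a single point.
   Neither the disjointness of I and J nor their position on the two sides of the top
   step is required separately: both follow from the strict monotonicity of the Inf
   and Sup of the level sets. *)
definition trapezoid :: "nat \<Rightarrow> (real \<Rightarrow> real) \<Rightarrow> bool" where
  "trapezoid N v \<longleftrightarrow> N \<ge> 1 \<and>
     (\<exists>t :: nat \<Rightarrow> real. 0 < t 1 \<and> strict_mono_on {1..N} t \<and>
        range v - {0} = t ` {1..N} \<and>
        open_or_half_open_interval (v -` {t N}) \<and>
        (\<exists>l>0. \<forall>i\<in>{1..<N}. \<exists>I J.
            interval_of_length l I \<and> interval_of_length l J \<and> v -` {t i} = I \<union> J) \<and>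
        strict_mono_on {1..N} (\<lambda>i. Inf (v -` {t i})) \<and>
        strict_antimono_on {1..N} (\<lambda>i. Sup (v -` {t i})))"

(* The steps may be half-open, so reflection can move an endpoint from one step to the
   adjacent one (the indicator function of [-1/2, 1/2) is to count as isosceles). The
   symmetry is therefore required at every point of continuity; for a trapezoid this
   exempts exactly the endpoints of its steps. *)
definition isosceles_trapezoid :: "nat \<Rightarrow> (real \<Rightarrow> real) \<Rightarrow> bool" where
  "isosceles_trapezoid N v \<longleftrightarrow>
     trapezoid N v \<and> (\<forall>z. isCont v z \<longrightarrow> v (- z) = v z)"

end

theory Submission
  imports Defs
begin

text \<open>Write \<open>\<rho> = p / q + \<theta>\<close>. If \<open>S(x) = z\<close> then \<open>q x\<close> is determined up to an integer \<open>n\<close>, so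
  there are \<open>q\<close> candidates for \<open>x\<close>, and \<open>n\<close> gives a solution exactly when
  \<open>(\<Sum>i=1..q. (n + i p + f i) div q) = n\<close>, where \<open>f i\<close> is the floor of \<open>i q \<theta>\<close> plus a constant
  depending on \<open>z\<close>. As \<open>(q - 1) q \<bar>\<theta>\<bar> < 1\<close>, \<open>f\<close> takes at most two consecutive values, and since
  \<open>i \<mapsto> i p\<close> permutes the residues modulo \<open>q\<close> the number of solutions is the number of
  \<open>i \<in> {1..q}\<close> such that \<open>z\<close> lies in the interval of length 1 centred at
  \<open>- q \<theta> (i - (q + 1) / 2)\<close>. These equally spaced intervals have a common point, so their
  overlap count is the isosceles trapezoid.\<close>

section \<open>Convergents: coprimality and the quadratic error bound\<close>

lemma cf_den_pos:
  assumes "\<forall>i\<ge>1. a i > 0"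
  shows "cf_den a n > 0"
  using assms by (induction a n rule: cf_den.induct) auto

text \<open>Inserting the recurrences cancels the terms with the partial quotient, so each step only
  flips the sign. Both coprimality and the error bound rest on this.\<close>

lemma cf_det:
  "int (cf_num a (Suc n)) * int (cf_den a n) - int (cf_num a n) * int (cf_den a (Suc n)) = (-1) ^ n"
  by (induction n) (auto simp: algebra_simps)

lemma coprime_cf: "coprime (cf_num a n) (cf_den a n)"
proof -
  have "coprime (int (cf_num a n)) (int (cf_den a n))"
  proof (rule coprimeI)
    fix d assume "d dvd int (cf_num a n)" "d dvd int (cf_den a n)"
    then have "d dvd (-1) ^ n"
      unfolding cf_det[of a n, symmetric] by (intro dvd_diff dvd_mult dvd_mult2)
    then show "is_unit d"
      by (cases "even n") auto
  qed
  then show ?thesis by simp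
qed

lemma cf_trunc_nonneg: "cf_trunc a k n \<ge> 0"
  by (induction a k n rule: cf_trunc.induct) auto

lemma cf_trunc_le_1:
  assumes "a k > 0"
  shows "cf_trunc a k n \<le> 1"
proof (cases n)
  case (Suc m)
  have "real (a k) + cf_trunc a (Suc k) m \<ge> 1"
    using assms cf_trunc_nonneg[of a "Suc k" m] by linarith
  then show ?thesis using Suc by simp
qed auto

text \<open>A deeper truncation is a Moebius function of its tail, with coefficients from two
  consecutive convergents. The induction moves one level out of the tail, so \<open>k\<close> must
  stay arbitrary.\<close>

lemma cf_trunc_add:
  assumes "\<forall>i\<ge>1. a i > 0"
  shows "cf_trunc a 1 (Suc n + k) =
    (cf_num a (Suc n) + cf_num a n * cf_trunc a (n + 2) k) /
    (cf_den a (Suc n) + cf_den a n * cf_trunc a (n + 2) k)"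
proof (induction n arbitrary: k)
  case 0
  then show ?case by (simp add: numeral_2_eq_2)
next
  case (Suc n)
  define \<tau> where "\<tau> = cf_trunc a (n + 3) k"
  have pos: "real (a (n + 2)) + \<tau> > 0"
    using assms cf_trunc_nonneg[of a "n + 3" k] unfolding \<tau>_def by (simp add: add_pos_nonneg)
  have step: "(x + y * (1 / s)) / (u + v * (1 / s)) = (s * x + y) / (s * u + v)"
    if "s > 0" for x y u v s :: real
  proof -
    have "x + y * (1 / s) = (s * x + y) / s" "u + v * (1 / s) = (s * u + v) / s"
      using that by (auto simp: field_simps)
    then show ?thesis using that by simp
  qed
  have "cf_trunc a 1 (Suc (Suc n) + k) = cf_trunc a 1 (Suc n + Suc k)"
    by (simp only: add_Suc_right add_Suc)
  also have "\<dots> = (cf_num a (Suc n) + cf_num a n * (1 / (a (n + 2) + \<tau>))) /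
      (cf_den a (Suc n) + cf_den a n * (1 / (a (n + 2) + \<tau>)))"
    unfolding Suc.IH \<tau>_def by (simp add: eval_nat_numeral)
  also have "\<dots> = ((a (n + 2) + \<tau>) * cf_num a (Suc n) + cf_num a n) /
      ((a (n + 2) + \<tau>) * cf_den a (Suc n) + cf_den a n)"
    by (rule step[OF pos])
  also have "\<dots> = (cf_num a (Suc (Suc n)) + cf_num a (Suc n) * \<tau>) /
      (cf_den a (Suc (Suc n)) + cf_den a (Suc n) * \<tau>)"
    by (simp add: algebra_simps)
  finally show ?case
    unfolding \<tau>_def by (simp add: eval_nat_numeral)
qed

text \<open>For \<open>n > 0\<close>, every truncation of depth at least \<open>n\<close> differs
  from \<open>p / q\<close> by \<open>\<tau> / (q * (q + q' * \<tau>))\<close> with a tail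
  \<open>\<tau>\<close> between 0 and 1; the resulting bound passes to the limit.\<close>

lemma cf_convergent_error:
  assumes "cf_convergent \<rho> p q" "0 < \<rho>" "\<rho> < 1"
  shows "q > 0" "coprime p q" "\<bar>\<rho> - p / q\<bar> \<le> 1 / (real q)\<^sup>2"
proof -
  obtain a n where a: "\<forall>i\<ge>1. a i > 0" and lim: "(\<lambda>n. cf_trunc a 1 n) \<longlonglongrightarrow> \<rho>"
    and p: "p = cf_num a n" and q: "q = cf_den a n"
    using assms unfolding cf_convergent_def cf_expansion_def by blast
  show "q > 0" using cf_den_pos[OF a] q by simp
  show "coprime p q" using coprime_cf p q by simp
  show "\<bar>\<rho> - p / q\<bar> \<le> 1 / (real q)\<^sup>2"
  proof (cases n)
    \<comment> \<open>Here \<open>p / q\<close> is \<open>0 / 1\<close>, and the bound is just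
      \<open>\<rho> \<le> 1\<close>.\<close>
    case 0
    then show ?thesis using p q assms by simp
  next
    case (Suc m)
    have bound: "\<bar>cf_trunc a 1 (k + n) - p / q\<bar> \<le> 1 / (real q)\<^sup>2" for k
    proof -
      define \<tau> where "\<tau> = cf_trunc a (m + 2) k"
      define p' q' where "p' = real (cf_num a m)" and "q' = real (cf_den a m)"
      have \<tau>: "0 \<le> \<tau>" "\<tau> \<le> 1"
        unfolding \<tau>_def using cf_trunc_nonneg cf_trunc_le_1 a by auto
      have q': "q' > 0" unfolding q'_def using cf_den_pos[OF a] by simp
      have q0: "real q > 0" using \<open>q > 0\<close> by simp
      have "real_of_int (int p * int (cf_den a m) - int (cf_num a m) * int q) = (-1) ^ m"
        using cf_det[of a m] Suc p q by simp
      then have det: "\<bar>p * q' - p' * q\<bar> = 1"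
        unfolding p'_def q'_def by simp
      have den: "q + q' * \<tau> > 0" using q0 q' \<tau> by (simp add: add_pos_nonneg)
      have "cf_trunc a 1 (k + n) = (p + p' * \<tau>) / (q + q' * \<tau>)"
        using cf_trunc_add[OF a, of m k] p q Suc
        unfolding \<tau>_def p'_def q'_def by (simp add: add.commute)
      also have "\<dots> - p / q = ((p + p' * \<tau>) * q - p * (q + q' * \<tau>)) / ((q + q' * \<tau>) * q)"
        using q0 den by (intro diff_frac_eq) auto
      also have "\<dots> = - (\<tau> * (p * q' - p' * q)) / (q * (q + q' * \<tau>))"
        by (simp add: algebra_simps)
      finally have "cf_trunc a 1 (k + n) - p / q = - (\<tau> * (p * q' - p' * q)) / (q * (q + q' * \<tau>))" .
      then have "\<bar>cf_trunc a 1 (k + n) - p / q\<bar> = \<tau> / (q * (q + q' * \<tau>))"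
        using \<tau> q0 den det by (simp add: abs_mult)
      also have "\<dots> \<le> 1 / (q * q)"
        using \<tau> q0 q' by (intro frac_le mult_left_mono) auto
      finally show ?thesis by (simp add: power2_eq_square)
    qed
    have "(\<lambda>k. \<bar>cf_trunc a 1 (k + n) - p / q\<bar>) \<longlonglongrightarrow> \<bar>\<rho> - p / q\<bar>"
      by (intro tendsto_intros LIMSEQ_ignore_initial_segment[OF lim])
    then show ?thesis
      using bound by (intro LIMSEQ_le_const2) auto
  qed
qed

section \<open>Integer quotients along an arithmetic progression modulo \<open>q\<close>\<close>

lemma inj_on_mult_mod:
  fixes p q :: nat and m :: int
  assumes "coprime p q"
  shows "inj_on (\<lambda>i. (m + int i * int p) mod int q) {1..q}"
proof (rule inj_onI)
  fix i j assume ij: "i \<in> {1..q}" "j \<in> {1..q}"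
    "(m + int i * int p) mod int q = (m + int j * int p) mod int q"
  then have "int q dvd (int i - int j) * int p"
    by (simp add: mod_eq_dvd_iff algebra_simps)
  then have "int q dvd int i - int j"
    using assms by (subst (asm) coprime_dvd_mult_left_iff) (simp_all add: coprime_commute)
  then show "i = j"
    using ij zdvd_imp_le[of "int q" "int i - int j"] zdvd_imp_le[of "int q" "int j - int i"]
    by (cases i j rule: linorder_cases) (auto simp: dvd_diff_commute)
qed

lemma bij_betw_mult_mod:
  fixes p q :: nat and m :: int
  assumes "coprime p q" "q > 0"
  shows "bij_betw (\<lambda>i. (m + int i * int p) mod int q) {1..q} {0..<int q}"
proof -
  have "(\<lambda>i. (m + int i * int p) mod int q) ` {1..q} = {0..<int q}"
    using inj_on_mult_mod[OF assms(1), of m] assms(2)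
    by (intro card_subset_eq) (auto simp: card_image)
  then show ?thesis
    using inj_on_mult_mod[OF assms(1), of m] by (simp add: bij_betw_def)
qed

lemma sum_atLeast1_nat:
  "2 * (\<Sum>i=1..q. int i) = int q * (int q + 1)"
  by (induction q) (auto simp: algebra_simps)

lemma sum_lessThan_int: "2 * (\<Sum>r\<in>{0..<int q}. r) = int q * (int q - 1)"
proof (induction q)
  case (Suc q)
  have "{0..<int (Suc q)} = insert (int q) {0..<int q}" by auto
  then show ?case using Suc by (simp add: algebra_simps)
qed auto

text \<open>The numbers \<open>m + i * p\<close> run through all residues modulo \<open>q\<close>,
  so their remainders have the same sum for every \<open>m\<close> and the quotients absorb the
  rest. Doubling avoids halves in the integers.\<close>

lemma sum_div_coprime:
  fixes p q :: nat and m :: int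
  assumes "coprime p q" "q > 0"
  shows "2 * (\<Sum>i=1..q. (m + int i * int p) div int q) = 2 * m + int p * (int q + 1) - (int q - 1)"
proof -
  let ?g = "\<lambda>i. m + int i * int p"
  have "(\<Sum>i=1..q. ?g i mod int q) = (\<Sum>r\<in>{0..<int q}. r)"
    by (rule sum.reindex_bij_betw[OF bij_betw_mult_mod[OF assms]])
  then have md: "2 * (\<Sum>i=1..q. ?g i mod int q) = int q * (int q - 1)"
    using sum_lessThan_int by simp
  have "(\<Sum>i=1..q. ?g i) = int q * m + (\<Sum>i=1..q. int i) * int p"
    by (simp add: sum.distrib sum_distrib_right)
  then have "2 * (\<Sum>i=1..q. ?g i) = 2 * (int q * m) + 2 * (\<Sum>i=1..q. int i) * int p"
    by simp
  then have tot: "2 * (\<Sum>i=1..q. ?g i) = int q * (2 * m + int p * (int q + 1))"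
    unfolding sum_atLeast1_nat by (simp add: algebra_simps)
  have "(\<Sum>i=1..q. ?g i) = (\<Sum>i=1..q. int q * (?g i div int q) + ?g i mod int q)"
    by simp
  also have "\<dots> = int q * (\<Sum>i=1..q. ?g i div int q) + (\<Sum>i=1..q. ?g i mod int q)"
    by (simp only: sum.distrib sum_distrib_left)
  finally have "int q * (2 * (\<Sum>i=1..q. ?g i div int q)) =
      int q * (2 * m + int p * (int q + 1) - (int q - 1))"
    using md tot by (simp add: algebra_simps)
  then show ?thesis using assms(2) by simp
qed

lemma div_add_one:
  fixes M q :: int
  assumes "q > 0"
  shows "(M + 1) div q = M div q + of_bool (q dvd M + 1)"
proof (cases "q dvd M + 1")
  case True
  then obtain k where k: "M + 1 = q * k" by auto
  then have "M = q * (k - 1) + (q - 1)" by (simp add: algebra_simps)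
  then have "M div q = k - 1" using assms by (intro int_div_pos_eq[of _ _ _ "q - 1"]) auto
  then show ?thesis using k assms by simp
next
  case False
  have "M mod q + 1 \<noteq> q"
  proof
    assume "M mod q + 1 = q"
    then have "M + 1 = q * (M div q) + q"
      using mult_div_mod_eq[of q M] by linarith
    then have "M + 1 = q * (M div q + 1)" by (simp add: distrib_left)
    then show False using False by simp
  qed
  moreover have "M mod q < q" "0 \<le> M mod q" using assms by auto
  ultimately have "(M + 1) div q = M div q"
    by (intro int_div_pos_eq[of _ _ _ "M mod q + 1"]) (auto simp: algebra_simps)
  then show ?thesis using False by simp
qed

text \<open>When \<open>f\<close> is constant the sum below is a translate of \<open>n\<close>; raising \<open>f i\<close> by one changes
  it only for the single \<open>n\<close> modulo \<open>q\<close> at which the \<open>i\<close>-th quotient jumps.\<close>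

lemma card_sum_div_fixed:
  fixes p q :: nat and m F c :: int and f :: "nat \<Rightarrow> int"
  assumes cop: "coprime p q" and q: "q > 0"
    and c: "2 * c = int p * (int q + 1) - (int q - 1)"
    and f: "\<And>i. i \<in> {1..q} \<Longrightarrow> f i = F \<or> f i = F + 1"
  shows "card {n \<in> {m..<m + int q}. (\<Sum>i=1..q. (n + int i * int p + f i) div int q) = n}
    = card {i \<in> {1..q}. f i = - c}"
proof -
  \<comment> \<open>\<open>h i\<close> is the one \<open>n\<close> in the window with
    \<open>n + i * p + F + 1\<close> divisible by \<open>q\<close>, that is, where the
    \<open>i\<close>-th quotient gains one when \<open>F\<close> becomes
    \<open>F + 1\<close>.\<close>
  define h where "h i = m + int q - 1 - (m + F + int q + int i * int p) mod int q" for i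
  have bij: "bij_betw h {1..q} {m..<m + int q}"
  proof -
    have "bij_betw (\<lambda>r. m + int q - 1 - r) {0..<int q} {m..<m + int q}"
      by (rule bij_betwI[where g = "\<lambda>n. m + int q - 1 - n"]) auto
    from bij_betw_trans[OF bij_betw_mult_mod[OF cop q] this] show ?thesis
      unfolding h_def comp_def .
  qed
  have dvd: "int q dvd h i + int j * int p + F + 1 \<longleftrightarrow> j = i"
    if "i \<in> {1..q}" "j \<in> {1..q}" for i j
  proof -
    let ?r = "\<lambda>i. (m + F + int q + int i * int p) mod int q"
    have "int q dvd h i + int j * int p + F + 1 \<longleftrightarrow>
        int q dvd (m + F + int q + int j * int p) - ?r i"
      unfolding h_def by (simp add: algebra_simps)
    also have "\<dots> \<longleftrightarrow> ?r j = ?r i"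
      by (simp add: mod_eq_dvd_iff[symmetric])
    also have "\<dots> \<longleftrightarrow> j = i"
      using inj_on_mult_mod[OF cop, of "m + F + int q"] that by (auto dest: inj_onD)
    finally show ?thesis .
  qed
  \<comment> \<open>At \<open>n = h i\<close> only the term \<open>j = i\<close> depends on whether
    \<open>f j\<close> is \<open>F\<close> or \<open>F + 1\<close>, so the sum is the translate
    \<open>h i + F + c\<close> plus \<open>f i - F\<close>.\<close>
  have sum_h: "(\<Sum>j=1..q. (h i + int j * int p + f j) div int q) = h i + f i + c"
    if i: "i \<in> {1..q}" for i
  proof -
    have "(\<Sum>j=1..q. (h i + int j * int p + f j) div int q) =
        (\<Sum>j=1..q. (h i + F + int j * int p) div int q + (if j = i then f i - F else 0))"
    proof (rule sum.cong[OF refl])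
      fix j assume j: "j \<in> {1..q}"
      show "(h i + int j * int p + f j) div int q =
          (h i + F + int j * int p) div int q + (if j = i then f i - F else 0)"
        using f[OF j] dvd[OF i j] div_add_one[of "int q" "h i + F + int j * int p"] q
        by (auto simp: ac_simps)
    qed
    also have "\<dots> = (\<Sum>j=1..q. (h i + F + int j * int p) div int q) + (f i - F)"
      using i by (simp add: sum.distrib)
    also have "\<dots> = h i + f i + c"
    proof -
      have "2 * (\<Sum>j=1..q. (h i + F + int j * int p) div int q) = 2 * (h i + F) + 2 * c"
        unfolding c sum_div_coprime[OF cop q] by simp
      then show ?thesis by simp
    qed
    finally show ?thesis .
  qed
  have "bij_betw h {i \<in> {1..q}. f i = - c}
      {n \<in> {m..<m + int q}. (\<Sum>i=1..q. (n + int i * int p + f i) div int q) = n}"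
  proof (rule bij_betw_imageI)
    show "inj_on h {i \<in> {1..q}. f i = - c}"
      using bij by (auto simp: bij_betw_def intro: inj_on_subset)
    have im: "{m..<m + int q} = h ` {1..q}" using bij by (simp add: bij_betw_def)
    have "(\<Sum>j=1..q. (h i + int j * int p + f j) div int q) = h i \<longleftrightarrow> f i = - c"
      if "i \<in> {1..q}" for i
      using sum_h[OF that] by auto
    then show "h ` {i \<in> {1..q}. f i = - c} =
        {n \<in> {m..<m + int q}. (\<Sum>i=1..q. (n + int i * int p + f i) div int q) = n}"
      unfolding im by blast
  qed
  then show ?thesis by (simp add: bij_betw_same_card)
qed

section \<open>Solutions of \<open>birkhoff_sum \<rho> q x = z\<close>\<close>

lemma floor_dichotomy:
  fixes b :: "nat \<Rightarrow> real"
  assumes "finite A" "A \<noteq> {}" "\<And>i j. i \<in> A \<Longrightarrow> j \<in> A \<Longrightarrow> b i - b j < 1"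
  obtains F where "\<And>i. i \<in> A \<Longrightarrow> \<lfloor>b i\<rfloor> = F \<or> \<lfloor>b i\<rfloor> = F + 1"
proof
  fix i assume i: "i \<in> A"
  have "Min (b ` A) \<in> b ` A" using assms by (intro Min_in) auto
  then obtain j where j: "j \<in> A" "Min (b ` A) = b j" by auto
  have "b j \<le> b i" using i j assms(1) by (metis Min_le finite_imageI imageI)
  moreover have "b i < b j + 1" using assms(3)[OF i j(1)] by simp
  ultimately show "\<lfloor>b i\<rfloor> = \<lfloor>Min (b ` A)\<rfloor> \<or> \<lfloor>b i\<rfloor> = \<lfloor>Min (b ` A)\<rfloor> + 1"
    unfolding j(2) by linarith
qed

text \<open>Solutions \<open>x\<close> correspond to integers \<open>n\<close>, and these, through
  \<open>card_sum_div_fixed\<close>, to indices \<open>i\<close>. The half-open condition on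
  \<open>z\<close> prescribes the value of a floor.\<close>

lemma birkhoff_density_eq_card:
  fixes p q :: nat and \<theta> z :: real
  assumes cop: "coprime p q" and q: "q > 0" and small: "(real q - 1) * (q * \<bar>\<theta>\<bar>) < 1"
  shows "birkhoff_density (p / q + \<theta>) q z =
    card {i \<in> {1..q}. - 1/2 \<le> z + q * \<theta> * (i - (q + 1) / 2)
                      \<and> z + q * \<theta> * (i - (q + 1) / 2) < 1/2} / q"
proof -
  define \<rho> where "\<rho> = p / q + \<theta>"
  \<comment> \<open>Chosen so that \<open>birkhoff_sum \<rho> q x = z\<close> reads
    \<open>q * x = w + n\<close>, with \<open>n\<close> the sum of the integer parts of
    \<open>x + i * \<rho>\<close>.\<close>
  define w where "w = z - (\<rho> * q * (q + 1) / 2 - q / 2)"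
  define f where "f i = \<lfloor>w + i * (q * \<theta>)\<rfloor>" for i :: nat
  define c where "c = (\<Sum>i=1..q. (int i * int p) div int q)"
  \<comment> \<open>With this start, \<open>{m..<m + int q}\<close> holds exactly the
    \<open>n\<close> for which \<open>(w + n) / q\<close> lies in \<open>{0..<1}\<close>.\<close>
  define m where "m = \<lceil>- w\<rceil>"
  have q0: "real q > 0" using q by simp
  have c: "2 * c = int p * (int q + 1) - (int q - 1)"
    using sum_div_coprime[OF cop q, of 0] by (simp add: c_def)
  then have "real_of_int (2 * c) = real_of_int (int p * (int q + 1) - (int q - 1))"
    by (simp only:)
  then have c_real: "2 * real_of_int c = p * (real q + 1) - (real q - 1)"
    by simp
  have sum_i: "2 * (\<Sum>i=1..q. real i) = q * (real q + 1)"
  proof -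
    have "real_of_int (2 * (\<Sum>i=1..q. int i)) = real_of_int (int q * (int q + 1))"
      by (simp only: sum_atLeast1_nat)
    then show ?thesis by simp
  qed
  have S: "birkhoff_sum \<rho> q x = q * x + (z - w) - real_of_int (\<Sum>i=1..q. \<lfloor>x + i * \<rho>\<rfloor>)" for x :: real
  proof -
    have "birkhoff_sum \<rho> q x = (\<Sum>i=1..q. x + i * \<rho> - \<lfloor>x + i * \<rho>\<rfloor> - 1 / 2)"
      by (simp add: birkhoff_sum_def frac_def)
    also have "\<dots> = q * x + (\<Sum>i=1..q. real i) * \<rho> - (\<Sum>i=1..q. \<lfloor>x + i * \<rho>\<rfloor>) - q / 2"
      by (simp add: sum.distrib sum_subtractf sum_distrib_right)
    finally show ?thesis using sum_i by (simp add: w_def algebra_simps)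
  qed
  have fl: "\<lfloor>(w + n) / q + i * \<rho>\<rfloor> = (n + int i * int p + f i) div int q" for n :: int and i :: nat
  proof -
    have "(w + n) / q + i * \<rho> = (w + i * (q * \<theta>) + of_int (n + int i * int p)) / real_of_int (int q)"
      using q0 by (simp add: \<rho>_def field_simps)
    then have "\<lfloor>(w + n) / q + i * \<rho>\<rfloor> = \<lfloor>w + i * (q * \<theta>) + of_int (n + int i * int p)\<rfloor> div int q"
      by (simp only: floor_divide_real_eq_div of_nat_0_le_iff)
    also have "\<lfloor>w + i * (q * \<theta>) + of_int (n + int i * int p)\<rfloor> = n + int i * int p + f i"
      using floor_add_int[of "w + i * (q * \<theta>)" "n + int i * int p"] unfolding f_def by linarith
    finally show ?thesis .
  qed
  have solutions: "{x \<in> {0..<1}. birkhoff_sum \<rho> q x = z} =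
      (\<lambda>n. (w + of_int n) / q) ` {n \<in> {m..<m + int q}. (\<Sum>i=1..q. (n + int i * int p + f i) div int q) = n}"
    (is "?L = ?R")
  proof (intro equalityI subsetI)
    fix x assume x: "x \<in> ?L"
    define n where "n = (\<Sum>i=1..q. \<lfloor>x + i * \<rho>\<rfloor>)"
    have "q * x = w + n" using x S[of x] by (simp add: n_def)
    then have xn: "x = (w + n) / q" using q0 by (simp add: field_simps)
    have "0 \<le> w + n" "w + n < q" using x q0 by (auto simp: xn field_simps)
    then have "n \<in> {m..<m + int q}" unfolding m_def by (auto simp: ceiling_le_iff) linarith
    moreover have "(\<Sum>i=1..q. (n + int i * int p + f i) div int q) = n"
      unfolding fl[symmetric] xn[symmetric] by (rule n_def[symmetric])
    ultimately show "x \<in> ?R" using xn by blast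
  next
    fix x assume "x \<in> ?R"
    then obtain n where n: "n \<in> {m..<m + int q}" "x = (w + of_int n) / q"
      and eq: "(\<Sum>i=1..q. (n + int i * int p + f i) div int q) = n" by blast
    have "0 \<le> w + n" "w + n < q" using n(1) unfolding m_def by (auto, linarith+)
    then have "x \<in> {0..<1}" unfolding n(2) using q0 by simp
    moreover have "birkhoff_sum \<rho> q x = z"
      unfolding S n(2) fl eq using q0 by simp
    ultimately show "x \<in> ?L" by simp
  qed
  \<comment> \<open>The hypothesis \<open>small\<close> enters here: the numbers whose floors are
    \<open>f i\<close> spread over less than 1, so \<open>f\<close> takes at most two consecutive
    values.\<close>
  have close: "(w + i * (q * \<theta>)) - (w + j * (q * \<theta>)) < 1" if "i \<in> {1..q}" "j \<in> {1..q}" for i j :: nat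
  proof -
    have "(w + i * (q * \<theta>)) - (w + j * (q * \<theta>)) = (real i - real j) * (q * \<theta>)"
      by (simp add: algebra_simps)
    also have "\<dots> \<le> \<bar>real i - real j\<bar> * (q * \<bar>\<theta>\<bar>)"
      using abs_ge_self[of "(real i - real j) * (q * \<theta>)"] by (simp add: abs_mult)
    also have "\<dots> \<le> (real q - 1) * (q * \<bar>\<theta>\<bar>)"
      using that by (intro mult_right_mono) auto
    finally show ?thesis using small by simp
  qed
  obtain F where F: "\<And>i. i \<in> {1..q} \<Longrightarrow> f i = F \<or> f i = F + 1"
    using floor_dichotomy[of "{1..q}" "\<lambda>i. w + i * (q * \<theta>)"] close q unfolding f_def by auto
  have "card {x \<in> {0..<1}. birkhoff_sum \<rho> q x = z} = card {i \<in> {1..q}. f i = - c}"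
  proof -
    have "card {x \<in> {0..<1}. birkhoff_sum \<rho> q x = z} =
        card {n \<in> {m..<m + int q}. (\<Sum>i=1..q. (n + int i * int p + f i) div int q) = n}"
      unfolding solutions by (rule card_image) (use q0 in \<open>auto simp: inj_on_def\<close>)
    also have "\<dots> = card {i \<in> {1..q}. f i = - c}"
      by (rule card_sum_div_fixed[OF cop q c]) (rule F)
    finally show ?thesis .
  qed
  \<comment> \<open>The constant \<open>c\<close> cancels the contribution of \<open>p / q\<close>
    to \<open>w\<close>; what remains is centred at the mean index
    \<open>(q + 1) / 2\<close>.\<close>
  also have "{i \<in> {1..q}. f i = - c} = {i \<in> {1..q}. - 1/2 \<le> z + q * \<theta> * (i - (q + 1) / 2)
                      \<and> z + q * \<theta> * (i - (q + 1) / 2) < 1/2}"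
  proof -
    have "\<rho> * q * (q + 1) / 2 = (p * (real q + 1) + \<theta> * q * (real q + 1)) / 2"
      using q0 by (simp add: \<rho>_def field_simps)
    then have "w + i * (q * \<theta>) + c = z + q * \<theta> * (i - (q + 1) / 2) + 1/2" for i :: nat
      using c_real unfolding w_def by (simp add: field_simps)
    moreover have "f i = - c \<longleftrightarrow> 0 \<le> w + i * (q * \<theta>) + c \<and> w + i * (q * \<theta>) + c < 1" for i
      unfolding f_def by (auto simp: floor_eq_iff)
    ultimately show ?thesis by auto
  qed
  finally show ?thesis
    unfolding birkhoff_density_def \<rho>_def by simp
qed

section \<open>Overlap count of equally spaced unit intervals\<close>

lemma downward_closed_eq_atLeastAtMost:
  fixes A :: "nat set"
  assumes "A \<subseteq> {1..N}" "\<And>i j. j \<in> A \<Longrightarrow> 1 \<le> i \<Longrightarrow> i \<le> j \<Longrightarrow> i \<in> A"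
  shows "A = {1..card A}"
proof (cases "A = {}")
  case False
  have fin: "finite A" using assms(1) finite_subset by blast
  have "A = {1..Max A}"
  proof (intro equalityI subsetI)
    fix i assume "i \<in> {1..Max A}"
    then show "i \<in> A" using assms(2)[OF Max_in[OF fin False]] by auto
  qed (use assms(1) fin in auto)
  then show ?thesis by (metis card_atLeastAtMost diff_Suc_1)
qed simp

lemma interval_of_length_atLeastLessThan:
  assumes "a < b"
  shows "interval_of_length (b - a) {a..<b}"
  using assms unfolding interval_of_length_def is_interval_1
  by (auto intro!: bounded_subset[OF bounded_closed_interval[of a b]])

lemma Inf_Sup_Un_atLeastLessThan:
  fixes a b c d :: real
  assumes "a < b" "c < d" "a \<le> c" "b \<le> d"
  shows "Inf ({a..<b} \<union> {c..<d}) = a" "Sup ({a..<b} \<union> {c..<d}) = d"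
  using assms by (simp_all add: cInf_union_distrib cSup_union_distrib inf_real_def sup_real_def)

text \<open>The \<open>u i\<close> are the centres of half-open unit intervals, placed symmetrically
  about 0, and \<open>K z\<close> collects the intervals that contain \<open>z\<close>. In the
  application \<open>N\<close> is \<open>q\<close> and \<open>\<delta>\<close> is
  \<open>q * \<bar>\<theta>\<bar>\<close>.\<close>

locale staircase =
  fixes N :: nat and \<delta> :: real and u :: "nat \<Rightarrow> real" and K :: "real \<Rightarrow> nat set"
  defines "u \<equiv> \<lambda>i. \<delta> * (i - (N + 1) / 2)"
    and "K \<equiv> \<lambda>z. {i \<in> {1..N}. u i - 1/2 \<le> z \<and> z < u i + 1/2}"
  assumes N: "N > 0" and \<delta>: "\<delta> > 0" and small: "(real N - 1) * \<delta> < 1"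
begin

lemma u_less_iff: "u i < u j \<longleftrightarrow> i < j" and u_le_iff: "u i \<le> u j \<longleftrightarrow> i \<le> j"
  using \<delta> by (auto simp: u_def)

lemma u_Suc: "u (Suc i) = u i + \<delta>"
  by (simp add: u_def algebra_simps)

lemma u_reflect: "i \<le> N \<Longrightarrow> u (Suc (N - i)) = - u i"
  by (simp add: u_def of_nat_diff field_simps)

text \<open>The centres span \<open>(N - 1) * \<delta>\<close>, less than the length of one
  interval. So, moving to the right, all intervals begin before any of them ends.\<close>

lemma u_spread:
  assumes "i \<in> {1..N}" "j \<in> {1..N}"
  shows "u i - 1/2 < u j + 1/2"
proof -
  have "u i - u j = (real i - real j) * \<delta>" by (simp add: u_def algebra_simps)
  also have "\<dots> \<le> (real N - 1) * \<delta>" using assms \<delta> by (intro mult_right_mono) auto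
  finally show ?thesis using small by linarith
qed

lemma card_K_le: "card (K z) \<le> N"
proof -
  have "card (K z) \<le> card {1..N}" by (rule card_mono) (auto simp: K_def)
  then show ?thesis by simp
qed

text \<open>On the left flank no interval has ended yet, by \<open>u_spread\<close>, so the left
  endpoints alone decide.\<close>

lemma K_left:
  assumes "k \<in> {1..<N}" "u k - 1/2 \<le> z" "z < u (Suc k) - 1/2"
  shows "K z = {1..k}"
proof (intro equalityI subsetI)
  fix i assume "i \<in> K z"
  then have "1 \<le> i" "u i < u (Suc k)" using assms by (auto simp: K_def)
  then show "i \<in> {1..k}" by (simp add: u_less_iff)
next
  fix i assume i: "i \<in> {1..k}"
  then have "u i \<le> u k" by (simp add: u_le_iff)
  moreover have "u (Suc k) - 1/2 < u i + 1/2" using i assms by (intro u_spread) auto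
  ultimately show "i \<in> K z" using i assms by (auto simp: K_def)
qed

text \<open>On the right flank every interval has begun, so the right endpoints alone decide: the
  first \<open>N - k\<close> have been passed and \<open>k\<close> intervals are left.\<close>

lemma K_right:
  assumes "k \<in> {1..<N}" "u (N - k) + 1/2 \<le> z" "z < u (Suc (N - k)) + 1/2"
  shows "K z = {Suc (N - k)..N}"
proof (intro equalityI subsetI)
  fix i assume "i \<in> K z"
  then have "i \<le> N" "u (N - k) < u i" using assms by (auto simp: K_def)
  then show "i \<in> {Suc (N - k)..N}" by (simp add: u_less_iff)
next
  fix i assume i: "i \<in> {Suc (N - k)..N}"
  then have "u (Suc (N - k)) \<le> u i" by (simp add: u_le_iff)
  moreover have "u i - 1/2 < u (N - k) + 1/2" using i assms by (intro u_spread) auto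
  ultimately show "i \<in> K z" using i assms by (auto simp: K_def)
qed

lemma K_top:
  assumes "u N - 1/2 \<le> z" "z < u 1 + 1/2"
  shows "K z = {1..N}"
proof -
  have "u i \<le> u N" "u 1 \<le> u i" if "i \<in> {1..N}" for i
    using that by (auto simp: u_le_iff)
  then show ?thesis using assms by (force simp: K_def)
qed

text \<open>Recovers the set from its size. The split point \<open>u 1 + 1/2\<close> is the first
  right endpoint: before it nothing has ended and \<open>K z\<close> is an initial segment; from it
  on everything has begun and the complement is an initial segment.\<close>

lemma K_eq_cases:
  assumes "card (K z) = k" "k > 0"
  obtains "K z = {1..k}" "z < u 1 + 1/2" "\<And>i. i \<in> {Suc k..N} \<Longrightarrow> z < u i - 1/2"
  | "K z = {Suc (N - k)..N}" "u 1 + 1/2 \<le> z" "\<And>i. i \<in> {1..N - k} \<Longrightarrow> u i + 1/2 \<le> z"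
proof (cases "z < u 1 + 1/2")
  case True
  have upper: "z < u i + 1/2" if "i \<in> {1..N}" for i
    using True u_le_iff[of 1 i] that by auto
  have "K z = {1..card (K z)}"
  proof (rule downward_closed_eq_atLeastAtMost)
    fix i j assume "j \<in> K z" "1 \<le> i" "i \<le> j"
    then show "i \<in> K z" using upper[of i] u_le_iff[of i j] by (auto simp: K_def)
  qed (auto simp: K_def)
  then have K: "K z = {1..k}" using assms by simp
  have "z < u i - 1/2" if "i \<in> {Suc k..N}" for i
  proof -
    have "i \<notin> K z" using that K by auto
    then show ?thesis using upper[of i] that by (auto simp: K_def)
  qed
  then show ?thesis using that(1) K True by blast
next
  case False
  have lower: "u i - 1/2 \<le> z" if "i \<in> {1..N}" for i
    using False u_spread[of i 1] that N by auto
  let ?C = "{1..N} - K z"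
  have sub: "K z \<subseteq> {1..N}" by (auto simp: K_def)
  have "?C = {1..card ?C}"
  proof (rule downward_closed_eq_atLeastAtMost)
    fix i j assume "j \<in> ?C" "1 \<le> i" "i \<le> j"
    then show "i \<in> ?C" using lower[of j] u_le_iff[of i j] by (auto simp: K_def)
  qed auto
  moreover have "card ?C = N - k"
    using assms sub by (subst card_Diff_subset) (auto intro: finite_subset)
  ultimately have C: "?C = {1..N - k}" by simp
  have "K z = {1..N} - ?C" using sub by blast
  also have "\<dots> = {Suc (N - k)..N}" unfolding C by auto
  finally have K: "K z = {Suc (N - k)..N}" .
  have "u i + 1/2 \<le> z" if "i \<in> {1..N - k}" for i
  proof -
    have "i \<in> {1..N}" "i \<notin> K z" using that C by blast+
    then show ?thesis using lower[of i] by (auto simp: K_def)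
  qed
  then show ?thesis using that(2) K False by simp
qed

lemma level_lateral:
  assumes k: "k \<in> {1..<N}"
  shows "{z. card (K z) = k} =
    {u k - 1/2..<u (Suc k) - 1/2} \<union> {u (N - k) + 1/2..<u (Suc (N - k)) + 1/2}" (is "?L = ?R")
proof (intro equalityI subsetI)
  fix z assume z: "z \<in> ?L"
  then have "card (K z) = k" "k > 0" using k by auto
  then show "z \<in> ?R"
  proof (cases rule: K_eq_cases)
    case 1
    then have "k \<in> K z" using k by auto
    then show ?thesis using 1(3)[of "Suc k"] k by (auto simp: K_def)
  next
    case 2
    then have "Suc (N - k) \<in> K z" using k by auto
    moreover have "N - k \<in> {1..N - k}" using k by auto
    ultimately show ?thesis using 2(3)[of "N - k"] by (auto simp: K_def)
  qed
next
  fix z assume "z \<in> ?R"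
  then show "z \<in> ?L" using K_left[OF k] K_right[OF k] k by auto
qed

lemma level_top: "{z. card (K z) = N} = {u N - 1/2..<u 1 + 1/2}" (is "?L = ?R")
proof (intro equalityI subsetI)
  fix z assume z: "z \<in> ?L"
  then have "card (K z) = N" by simp
  then have "K z = {1..N}" using N by (cases rule: K_eq_cases) auto
  then have "1 \<in> K z" "N \<in> K z" using N by auto
  then show "z \<in> ?R" by (auto simp: K_def)
next
  fix z assume "z \<in> ?R"
  then show "z \<in> ?L" using K_top by auto
qed

text \<open>Since \<open>Suc (N - N) = 1\<close>, the plateau obeys the same formulas as the lateral
  levels, and monotonicity of the endpoints in \<open>k\<close> reduces to that of
  \<open>u\<close>.\<close>

lemma Inf_Sup_level:
  assumes "k \<in> {1..N}"
  shows "Inf {z. card (K z) = k} = u k - 1/2"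
    and "Sup {z. card (K z) = k} = u (Suc (N - k)) + 1/2"
proof -
  have top: "u N - 1/2 < u 1 + 1/2" using u_spread[of N 1] N by auto
  have lat: "Inf {z. card (K z) = k} = u k - 1/2 \<and> Sup {z. card (K z) = k} = u (Suc (N - k)) + 1/2"
    if k: "k \<in> {1..<N}"
  proof -
    \<comment> \<open>Each end of the left piece lies before the matching end of the right piece, so
      the infimum comes from the left piece and the supremum from the right one.\<close>
    have "u k - 1/2 < u (N - k) + 1/2" "u (Suc k) - 1/2 < u (Suc (N - k)) + 1/2"
      by (rule u_spread; use k in auto)+
    then show ?thesis
      unfolding level_lateral[OF k] using \<delta>
      by (intro conjI Inf_Sup_Un_atLeastLessThan) (auto simp: u_Suc)
  qed
  have "k = N \<or> k \<in> {1..<N}" using assms by auto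
  then show "Inf {z. card (K z) = k} = u k - 1/2"
    and "Sup {z. card (K z) = k} = u (Suc (N - k)) + 1/2"
    using lat level_top top by auto
qed

lemma level_nonempty:
  assumes "k \<in> {1..N}"
  obtains z where "card (K z) = k"
proof (cases "k = N")
  case True
  have "u N - 1/2 \<in> {z. card (K z) = N}"
    unfolding level_top using u_spread[of N 1] N by auto
  then show ?thesis using that True by auto
next
  case False
  then have k: "k \<in> {1..<N}" using assms by auto
  have "u k - 1/2 \<in> {z. card (K z) = k}"
    unfolding level_lateral[OF k] using \<delta> by (simp add: u_Suc)
  then show ?thesis using that by auto
qed

text \<open>The heights are \<open>k / N\<close>, and each lateral step has length
  \<open>\<delta>\<close>, the distance between neighbouring endpoints of the same side.\<close>

lemma trapezoid_card_K: "trapezoid N (\<lambda>z. card (K z) / N)"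
proof -
  let ?v = "\<lambda>z. real (card (K z)) / N" and ?t = "\<lambda>k. real k / N"
  have level: "?v -` {?t k} = {z. card (K z) = k}" for k
    using N by auto
  have "range ?v - {0} = ?t ` {1..N}"
  proof (intro equalityI subsetI)
    fix y assume "y \<in> range ?v - {0}"
    then obtain z where "y = ?t (card (K z))" "card (K z) \<noteq> 0" by force
    then show "y \<in> ?t ` {1..N}" using card_K_le[of z] by (intro image_eqI[of _ _ "card (K z)"]) auto
  next
    fix y assume "y \<in> ?t ` {1..N}"
    then obtain k where k: "k \<in> {1..N}" "y = ?t k" by blast
    then obtain z where "card (K z) = k" using level_nonempty by metis
    then show "y \<in> range ?v - {0}" using k by force
  qed
  moreover have "open_or_half_open_interval (?v -` {?t N})"
    unfolding level level_top open_or_half_open_interval_def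
    using u_spread[of N 1] N by (intro exI[of _ "u N - 1/2"] exI[of _ "u 1 + 1/2"]) auto
  moreover have "\<exists>I J. interval_of_length \<delta> I \<and> interval_of_length \<delta> J \<and> ?v -` {?t k} = I \<union> J"
    if k: "k \<in> {1..<N}" for k
  proof -
    have "interval_of_length \<delta> {u k - 1/2..<u (Suc k) - 1/2}"
      using interval_of_length_atLeastLessThan[of "u k - 1/2" "u (Suc k) - 1/2"] \<delta> by (simp add: u_Suc)
    moreover have "interval_of_length \<delta> {u (N - k) + 1/2..<u (Suc (N - k)) + 1/2}"
      using interval_of_length_atLeastLessThan[of "u (N - k) + 1/2" "u (Suc (N - k)) + 1/2"] \<delta>
      by (simp add: u_Suc)
    ultimately show ?thesis unfolding level level_lateral[OF k] by blast
  qed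
  moreover have "strict_mono_on {1..N} (\<lambda>k. Inf (?v -` {?t k}))"
    unfolding level by (rule monotone_onI) (simp add: Inf_Sup_level u_less_iff)
  moreover have "strict_antimono_on {1..N} (\<lambda>k. Sup (?v -` {?t k}))"
    unfolding level by (rule monotone_onI) (auto simp: Inf_Sup_level u_less_iff)
  moreover have "strict_mono_on {1..N} ?t" "0 < ?t 1"
    using N by (auto intro!: monotone_onI divide_strict_right_mono)
  ultimately show ?thesis
    unfolding trapezoid_def using N \<delta> by (intro conjI exI[of _ ?t] exI[of _ \<delta>] ballI) auto
qed

text \<open>Reflection exchanges the closed and open ends of the intervals, so \<open>card (K (- z))\<close> is
  the left limit of \<open>\<lambda>y. card (K y)\<close> at \<open>z\<close>.\<close>

lemma eventually_card_K_reflect: "\<forall>\<^sub>F y in at_left z. card (K y) = card (K (- z))"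
proof -
  let ?R = "{i \<in> {1..N}. u i - 1/2 < z \<and> z \<le> u i + 1/2}"
  have "\<forall>\<^sub>F y in at_left z. \<forall>i\<in>{1..N}. (u i - 1/2 \<le> y \<and> y < u i + 1/2) = (u i - 1/2 < z \<and> z \<le> u i + 1/2)"
  proof (intro eventually_ball_finite ballI)
    fix i
    have ev: "\<forall>\<^sub>F y in at_left z. c < z \<longrightarrow> c < y" "\<forall>\<^sub>F y in at_left z. y < z" for c :: real
      by (auto simp: eventually_at_left_field intro: lt_ex)
    show "\<forall>\<^sub>F y in at_left z. (u i - 1/2 \<le> y \<and> y < u i + 1/2) = (u i - 1/2 < z \<and> z \<le> u i + 1/2)"
      using ev(1)[of "u i - 1/2"] ev(1)[of "u i + 1/2"] ev(2)
      by eventually_elim auto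
  qed simp
  then have "\<forall>\<^sub>F y in at_left z. K y = ?R"
    by eventually_elim (auto simp: K_def)
  moreover have "card ?R = card (K (- z))"
  proof (rule bij_betw_same_card)
    show "bij_betw (\<lambda>i. Suc (N - i)) ?R (K (- z))"
      by (rule bij_betwI[where g = "\<lambda>i. Suc (N - i)"]) (auto simp: K_def u_reflect)
  qed
  ultimately show ?thesis by (auto elim: eventually_mono)
qed

text \<open>At a point of continuity the value equals the left limit, which is the value at
  \<open>- z\<close> by \<open>eventually_card_K_reflect\<close>.\<close>

lemma isosceles_trapezoid_card_K: "isosceles_trapezoid N (\<lambda>z. card (K z) / N)"
proof -
  have "card (K (- z)) / N = card (K z) / N" if "isCont (\<lambda>z. card (K z) / N) z" for z
  proof (rule tendsto_unique)
    show "((\<lambda>y. card (K y) / N) \<longlongrightarrow> card (K z) / N) (at_left z)"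
      using that unfolding isCont_def by (rule filterlim_mono) (auto intro: at_le)
    show "((\<lambda>y. card (K y) / N) \<longlongrightarrow> card (K (- z)) / N) (at_left z)"
      by (rule tendsto_eventually) (use eventually_card_K_reflect[of z] in eventually_elim, simp)
  qed simp
  then show ?thesis using trapezoid_card_K by (simp add: isosceles_trapezoid_def)
qed

end

text \<open>The intervals counted are centred at \<open>- \<delta> * (i - (N + 1) / 2)\<close>. For
  negative \<open>\<delta>\<close> these are the centres of the locale in the same order; otherwise
  \<open>i \<mapsto> N + 1 - i\<close> reverses the order.\<close>

lemma isosceles_trapezoid_card:
  fixes N :: nat and \<delta> :: real
  assumes N: "N > 0" and \<delta>: "\<delta> \<noteq> 0" and small: "(real N - 1) * \<bar>\<delta>\<bar> < 1"
  shows "isosceles_trapezoid N (\<lambda>z. card {i \<in> {1..N}. - 1/2 \<le> z + \<delta> * (i - (N + 1) / 2)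
                                        \<and> z + \<delta> * (i - (N + 1) / 2) < 1/2} / N)"
    (is "isosceles_trapezoid N (\<lambda>z. card (?A z) / N)")
proof -
  interpret staircase N "\<bar>\<delta>\<bar>" "\<lambda>i. \<bar>\<delta>\<bar> * (i - (N + 1) / 2)"
    "\<lambda>z. {i \<in> {1..N}. \<bar>\<delta>\<bar> * (i - (N + 1) / 2) - 1/2 \<le> z \<and> z < \<bar>\<delta>\<bar> * (i - (N + 1) / 2) + 1/2}"
    by unfold_locales (use assms in auto)
  let ?K = "\<lambda>z. {i \<in> {1..N}. \<bar>\<delta>\<bar> * (i - (N + 1) / 2) - 1/2 \<le> z \<and> z < \<bar>\<delta>\<bar> * (i - (N + 1) / 2) + 1/2}"
  have "card (?A z) = card (?K z)" for z
  proof (cases "\<delta> < 0")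
    case True
    then have "\<bar>\<delta>\<bar> * x = - (\<delta> * x)" for x by simp
    then have "?A z = ?K z" by auto
    then show ?thesis by (simp only:)
  next
    case False
    have refl: "real (N + 1 - i) - (N + 1) / 2 = - (i - (N + 1) / 2)" if "i \<in> {1..N}" for i
      using that by (simp add: of_nat_diff field_simps)
    have "bij_betw (\<lambda>i. N + 1 - i) (?A z) (?K z)"
    proof (rule bij_betwI[where g = "\<lambda>i. N + 1 - i"])
      show "(\<lambda>i. N + 1 - i) \<in> ?A z \<rightarrow> ?K z"
      proof
        fix i assume i: "i \<in> ?A z"
        then have "\<bar>\<delta>\<bar> * (real (N + 1 - i) - (N + 1) / 2) = - (\<delta> * (i - (N + 1) / 2))"
          using False i by (simp only: refl mult_minus_right abs_of_nonneg not_less mem_Collect_eq)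
        then show "N + 1 - i \<in> ?K z" using i by auto
      qed
      show "(\<lambda>i. N + 1 - i) \<in> ?K z \<rightarrow> ?A z"
      proof
        fix i assume i: "i \<in> ?K z"
        then have "\<delta> * (real (N + 1 - i) - (N + 1) / 2) = - (\<bar>\<delta>\<bar> * (i - (N + 1) / 2))"
          using False i by (simp only: refl mult_minus_right abs_of_nonneg not_less mem_Collect_eq)
        then show "N + 1 - i \<in> ?A z" using i by auto
      qed
    qed auto
    then show ?thesis by (rule bij_betw_same_card)
  qed
  then show ?thesis using isosceles_trapezoid_card_K by simp
qed

theorem theorem4p7:
  fixes \<rho> :: real and p q :: nat
  assumes "0 < \<rho>" and "\<rho> < 1" and "\<rho> \<notin> \<rat>"
    and "cf_convergent \<rho> p q"
  shows "isosceles_trapezoid q (birkhoff_density \<rho> q)"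
proof -
  define \<theta> where "\<theta> = \<rho> - p / q"
  note conv = cf_convergent_error[OF assms(4,1,2)]
  have q0: "real q > 0" using conv(1) by simp
  \<comment> \<open>Irrationality enters here: the lateral steps have length
    \<open>q * \<bar>\<theta>\<bar>\<close>, which must be positive.\<close>
  have "\<rho> \<noteq> p / q"
    using assms(3) by (metis Rats_divide Rats_of_nat)
  then have \<theta>: "\<theta> \<noteq> 0" unfolding \<theta>_def by simp
  have "(real q)\<^sup>2 * \<bar>\<theta>\<bar> \<le> 1"
    using conv(3) q0 unfolding \<theta>_def by (simp add: field_simps)
  \<comment> \<open>The error bound is not strict; strictness comes from \<open>q - 1 < q\<close>
    together with \<open>\<theta> \<noteq> 0\<close>.\<close>
  moreover have "(real q - 1) * (q * \<bar>\<theta>\<bar>) < (real q)\<^sup>2 * \<bar>\<theta>\<bar>"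
    using q0 \<theta> by (simp add: power2_eq_square algebra_simps)
  ultimately have small: "(real q - 1) * (q * \<bar>\<theta>\<bar>) < 1" by linarith
  have "birkhoff_density \<rho> q = (\<lambda>z. card {i \<in> {1..q}. - 1/2 \<le> z + q * \<theta> * (i - (q + 1) / 2)
      \<and> z + q * \<theta> * (i - (q + 1) / 2) < 1/2} / q)"
    using birkhoff_density_eq_card[OF conv(2,1) small] by (auto simp: \<theta>_def)
  then show ?thesis
    using isosceles_trapezoid_card[of q "q * \<theta>"] conv(1) \<theta> small by (simp add: abs_mult)
qed

end
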